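(* Let $\mathbf{y}_1,\dots,\mathbf{y}_N\in\mathbb{R}^n$, $\mathbf{Y}_{-N}=[\mathbf{y}_1\cdots\mathbf{y}_{N-1}]\in\mathbb{R}^{n\times(N-1)}$, $\lambda>0$, and $\mathbf{W}_N=\mathrm{diag}\{w_1^{(N)},\dots,w_{N-1}^{(N)}\}$ with all $w_j^{(N)}>0$. Let $\mathbf{c}_N^*=[c_{N,1}^*\ \cdots\ c_{N,N-1}^*]^T\in\mathbb{R}^{N-1}$ be the optimal solution of the weighted LASSO $$\mathbf{c}_N^*=\arg\min_{\mathbf{c}}\ \lambda\|\mathbf{W}_N\mathbf{c}\|_1+\tfrac12\|\mathbf{y}_N-\mathbf{Y}_{-N}\mathbf{c}\|_2^2,$$ and let $\mathbf{z}^*(\mathbf{y}_N)\in\mathbb{R}^n$ be the optimal solution of the dual problem $$\mathbf{z}^*(\mathbf{y}_N)=\arg\min_{\mathbf{z}\in\mathcal{P}}\|\mathbf{z}-\mathbf{y}_N\|_2^2,\qquad \mathcal{P}=\{\mathbf{z}\in\mathbb{R}^n : \|\mathbf{W}_N^{-1}\mathbf{Y}_{-N}^T\mathbf{z}\|_\infty\le\lambda\}.$$ Then, for $1\le j\le N-1$: (a) If $c_{N,j}^*\ne0$, then $(1/w_j^{(N)})\,|\mathbf{y}_j^T\mathbf{z}^*(\mathbf{y}_N)|=\lambda$. (b) Assume that $(1/w_j^{(N)})\,|\mathbf{y}_j^T\mathbf{z}^*(\mathbf{y}_N)|=\lambda$. If $c_{N,j}^*=0$, then $\mathbf{y}_N\in\mathcal{H}\subset\mathbb{R}^n$,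 where $\mathcal{H}$ is a translation of a subspace of dimension less than $n$.
   Context: Standing assumptions: the ambient dimension $n$ is larger than $N$, and the columns of $\mathbf{Y}_{-N}$ are linearly independent. *)

theory Defs
  imports "HOL-Analysis.Analysis"
begin

text \<open>
  The index type \<open>'m\<close> plays the role of \<open>{1..N-1}\<close>, so \<open>N = CARD('m) + 1\<close>, and
  \<open>\<real>\<^sup>n\<close> is \<^typ>\<open>real ^ 'n\<close>.
  The vectors \<open>y\<^sub>1, \<dots>, y\<^sub>N\<^sub>-\<^sub>1\<close> are a family \<open>y :: 'm \<Rightarrow> real ^ 'n\<close>; the last vector
  \<open>y\<^sub>N\<close> is kept separate.
\<close>

definition data_matrix :: "('m \<Rightarrow> real ^ 'n) \<Rightarrow> real ^ 'm ^ 'n" where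
  "data_matrix y = (\<chi> i j. y j $ i)"

definition diag_matrix :: "('m \<Rightarrow> real) \<Rightarrow> real ^ 'm ^ 'm" where
  "diag_matrix w = (\<chi> i j. if i = j then w i else 0)"

definition l1norm :: "real ^ 'm \<Rightarrow> real" where
  "l1norm v = (\<Sum>i\<in>UNIV. \<bar>v $ i\<bar>)"

definition lasso_objective ::
  "real \<Rightarrow> ('m::finite \<Rightarrow> real) \<Rightarrow> ('m \<Rightarrow> real ^ 'n) \<Rightarrow> real ^ 'n \<Rightarrow> real ^ 'm \<Rightarrow> real" where
  "lasso_objective lam w y yN c =
     lam * l1norm (diag_matrix w *v c) + 1/2 * (norm (yN - data_matrix y *v c))\<^sup>2"

definition lasso_solution ::
  "real \<Rightarrow> ('m::finite \<Rightarrow> real) \<Rightarrow> ('m \<Rightarrow> real ^ 'n) \<Rightarrow> real ^ 'n \<Rightarrow> real ^ 'm \<Rightarrow> bool" where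
  "lasso_solution lam w y yN c \<longleftrightarrow> is_arg_min (lasso_objective lam w y yN) (\<lambda>_. True) c"

definition dual_polytope ::
  "real \<Rightarrow> ('m::finite \<Rightarrow> real) \<Rightarrow> ('m \<Rightarrow> real ^ 'n) \<Rightarrow> (real ^ 'n) set" where
  "dual_polytope lam w y =
     {z. infnorm (matrix_inv (diag_matrix w) *v (transpose (data_matrix y) *v z)) \<le> lam}"

definition dual_solution ::
  "real \<Rightarrow> ('m::finite \<Rightarrow> real) \<Rightarrow> ('m \<Rightarrow> real ^ 'n) \<Rightarrow> real ^ 'n \<Rightarrow> real ^ 'n \<Rightarrow> bool" where
  "dual_solution lam w y yN z \<longleftrightarrow>
     is_arg_min (\<lambda>z. (norm (z - yN))\<^sup>2) (\<lambda>z. z \<in> dual_polytope lam w y) z"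

definition proper_subspace_translate :: "(real ^ 'n) set \<Rightarrow> bool" where
  "proper_subspace_translate H \<longleftrightarrow>
     (\<exists>S a. subspace S \<and> dim S < CARD('n) \<and> H = (\<lambda>x. a + x) ` S)"

text \<open>
  If the translated subspace containing \<open>y\<^sub>N\<close> could be chosen freely after \<open>y\<^sub>N\<close>, membership would
  be trivial: take \<open>{y\<^sub>N}\<close>.  It also cannot be one and the same set for all \<open>y\<^sub>N\<close>, since it depends
  on the sign pattern of the LASSO solution and on the sign of \<open>y\<^sub>j\<^sup>T z\<^sup>*\<close>: with zero LASSO solution
  the two sets \<open>y\<^sub>j\<^sup>T y\<^sub>N = \<plusminus> \<lambda> w\<^sub>j\<close> already both occur.  Hence the theorem provides a finite
  family of translated proper subspaces, fixed before \<open>y\<^sub>N\<close> is given, one of whose members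
  contains \<open>y\<^sub>N\<close>.
\<close>

end

theory Submission imports Defs begin

text \<open>
  The residual \<open>r = y\<^sub>N - Y c\<close> of a LASSO solution satisfies the optimality conditions
  \<open>\<bar>y\<^sub>i \<bullet> r\<bar> \<le> \<lambda> w\<^sub>i\<close> and \<open>c\<^sub>i (y\<^sub>i \<bullet> r) = \<lambda> w\<^sub>i \<bar>c\<^sub>i\<bar>\<close>.  They say that \<open>r\<close> is feasible for the dual
  problem and satisfies the variational inequality of the projection onto the dual polytope, so
  \<open>z\<^sup>* = r\<close>, which gives (a).

  For (b), let \<open>S\<close> be the support of \<open>c\<close> and let \<open>u \<noteq> 0\<close> be the component of \<open>y\<^sub>j\<close> orthogonal to
  \<open>span {y\<^sub>i | i \<in> S}\<close>.  Then \<open>u \<bullet> y\<^sub>N = u \<bullet> r\<close>, and as \<open>u\<close> is a combination of \<open>y\<^sub>j\<close> and the \<open>y\<^sub>i\<close>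
  with \<open>i \<in> S\<close>, the number \<open>u \<bullet> r\<close> is determined by \<open>S\<close> and the signs of the \<open>y\<^sub>i \<bullet> r = \<plusminus>\<lambda> w\<^sub>i\<close>.
  So \<open>y\<^sub>N\<close> lies on one of finitely many hyperplanes, one for each sign pattern.
\<close>

lemma data_matrix_mult: "data_matrix y *v c = (\<Sum>i\<in>UNIV. c $ i *\<^sub>R y i)"
  by (simp add: vec_eq_iff matrix_vector_mult_def data_matrix_def mult.commute)

lemma transpose_data_matrix_mult_nth: "(transpose (data_matrix y) *v z) $ i = y i \<bullet> z"
  by (simp add: matrix_vector_mult_def data_matrix_def transpose_def inner_vec_def)

lemma diag_matrix_mult_nth: "(diag_matrix w *v c) $ i = w i * c $ i"
  for c :: "real ^ 'm::finite"
  by (simp add: matrix_vector_mult_def diag_matrix_def if_distrib[of "\<lambda>a. a * _"] cong: if_cong)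

lemma matrix_inv_diag_matrix:
  fixes w :: "'m::finite \<Rightarrow> real"
  assumes "\<And>i. w i \<noteq> 0"
  shows "matrix_inv (diag_matrix w) = diag_matrix (\<lambda>i. 1 / w i)"
proof -
  have inv: "diag_matrix w ** diag_matrix (\<lambda>i. 1 / w i) = mat 1"
    "diag_matrix (\<lambda>i. 1 / w i) ** diag_matrix w = mat 1"
    by (simp_all add: matrix_eq vec_eq_iff diag_matrix_mult_nth assms
        flip: matrix_vector_mul_assoc)
  show ?thesis
    unfolding matrix_inv_def
  proof (rule some_equality)
    \<comment> \<open>\<open>matrix_inv\<close> is a Hilbert choice, so any two-sided inverse
      \<open>B\<close> has to be identified.\<close>
    fix B assume B: "diag_matrix w ** B = mat 1 \<and> B ** diag_matrix w = mat 1"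
    have "B = (B ** diag_matrix w) ** diag_matrix (\<lambda>i. 1 / w i)"
      using inv by (simp flip: matrix_mul_assoc)
    with B show "B = diag_matrix (\<lambda>i. 1 / w i)" by simp
  qed (use inv in blast)
qed

lemma infnorm_le_iff_cart: "infnorm x \<le> b \<longleftrightarrow> (\<forall>i. \<bar>x $ i\<bar> \<le> b)"
  for x :: "real ^ 'm::finite"
  by (auto simp: infnorm_Max Basis_vec_def inner_axis)

lemma dual_polytope_iff:
  assumes "\<And>i. w i > 0"
  shows "z \<in> dual_polytope lam w y \<longleftrightarrow> (\<forall>i. \<bar>y i \<bullet> z\<bar> \<le> lam * w i)"
proof -
  have "w i \<noteq> 0" for i using assms[of i] by simp
  moreover have "\<bar>1 / w i * t\<bar> \<le> lam \<longleftrightarrow> \<bar>t\<bar> \<le> lam * w i" for i t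
    using assms[of i] by (simp add: abs_mult field_simps)
  ultimately show ?thesis
    unfolding dual_polytope_def
    by (simp add: matrix_inv_diag_matrix infnorm_le_iff_cart diag_matrix_mult_nth
        transpose_data_matrix_mult_nth
        del: times_divide_eq_left transpose_matrix_vector)
qed

text \<open>Stands in for differentiation: a perturbation inequality divided by the step
  \<open>e\<close> takes this form, and \<open>e\<close> tends to 0 from the right.\<close>

lemma le_zero_if_le_small_mult:
  fixes p k :: real
  assumes "\<And>e. 0 < e \<Longrightarrow> e < 1 \<Longrightarrow> p \<le> e * k"
  shows "p \<le> 0"
proof (rule tendsto_lowerbound)
  show "((\<lambda>e. e * k) \<longlongrightarrow> 0) (at_right 0)"
    by (auto intro!: tendsto_eq_intros)
  show "\<forall>\<^sub>F e in at_right 0. p \<le> e * k"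
    using assms by (auto simp: eventually_at_right_field intro!: exI[of _ 1])
qed simp

text \<open>The hypothesis says that \<open>t = 0\<close> is a minimiser; first-order optimality
  then puts \<open>b\<close> into \<open>a\<close> times the subdifferential of the absolute value
  at \<open>x\<close>, which is what the two conclusions express.\<close>

lemma abs_subgradient:
  fixes a b k x :: real
  assumes "a \<ge> 0" and min: "\<And>t. a * \<bar>x\<bar> \<le> a * \<bar>x + t\<bar> - t * b + t\<^sup>2 * k"
  shows "\<bar>b\<bar> \<le> a" and "b * x = a * \<bar>x\<bar>"
proof -
  have "s * b - a \<le> 0" if "\<bar>s\<bar> = 1" for s
  proof (rule le_zero_if_le_small_mult)
    fix e :: real assume e: "0 < e" "e < 1"
    have "a * \<bar>x + e * s\<bar> \<le> a * \<bar>x\<bar> + a * e"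
      using mult_left_mono[OF abs_triangle_ineq[of x "e * s"] \<open>a \<ge> 0\<close>] e that
      by (simp add: abs_mult distrib_left)
    moreover have "(e * s)\<^sup>2 = e * e"
      using that
      by (metis mult.right_neutral power_mult_distrib power2_abs power2_eq_square power_one)
    ultimately have "e * (s * b - a) \<le> e * (e * k)"
      using min[of "e * s"] by (simp add: algebra_simps)
    then show "s * b - a \<le> e * k" using e by simp
  qed
  from this[of 1] this[of "-1"] show le: "\<bar>b\<bar> \<le> a" by simp
  \<comment> \<open>Shrinking \<open>x\<close> by \<open>t = - e * x\<close> scales its absolute
    value by exactly \<open>1 - e\<close>, so the first-order term is available without a case split
    on the sign of \<open>x\<close>.\<close>
  have "a * \<bar>x\<bar> - b * x \<le> 0"
  proof (rule le_zero_if_le_small_mult)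
    fix e :: real assume e: "0 < e" "e < 1"
    have "x + - e * x = (1 - e) * x" by (simp add: algebra_simps)
    then have "\<bar>x + - e * x\<bar> = (1 - e) * \<bar>x\<bar>"
      using e by (simp add: abs_mult del: mult_minus_left)
    with min[of "- e * x"]
    have "a * \<bar>x\<bar> \<le> a * ((1 - e) * \<bar>x\<bar>) - (- e * x) * b + (- e * x)\<^sup>2 * k" by simp
    then have "e * (a * \<bar>x\<bar> - b * x) \<le> e * (e * (x\<^sup>2 * k))"
      by (simp add: algebra_simps power2_eq_square)
    then show "a * \<bar>x\<bar> - b * x \<le> e * (x\<^sup>2 * k)" using e by simp
  qed
  moreover have "b * x \<le> a * \<bar>x\<bar>"
    using abs_ge_self[of "b * x"] mult_right_mono[OF le, of "\<bar>x\<bar>"] by (simp add: abs_mult)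
  ultimately show "b * x = a * \<bar>x\<bar>" by simp
qed

text \<open>Along the \<open>i\<close>-th coordinate direction through \<open>c\<close>, the
  objective reduces to the one-variable problem of \<open>abs_subgradient\<close> with
  \<open>a = lam * w i\<close>, \<open>b = y i \<bullet> r\<close> and
  \<open>k = (norm (y i))\<^sup>2 / 2\<close>.\<close>

lemma lasso_optimality:
  fixes y :: "'m::finite \<Rightarrow> real ^ 'n"
  assumes sol: "lasso_solution lam w y yN c" and "lam > 0" and w: "\<And>i. w i > 0"
  defines "r \<equiv> yN - data_matrix y *v c"
  shows "\<bar>y i \<bullet> r\<bar> \<le> lam * w i" and "(y i \<bullet> r) * c $ i = lam * w i * \<bar>c $ i\<bar>"
proof -
  have min: "lam * w i * \<bar>c $ i\<bar>
      \<le> lam * w i * \<bar>c $ i + t\<bar> - t * (y i \<bullet> r) + t\<^sup>2 * ((norm (y i))\<^sup>2 / 2)" for t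
  proof -
    define d where "d = c + t *\<^sub>R axis i 1"
    have d: "d $ k = (if k = i then c $ i + t else c $ k)" for k
      by (simp add: d_def axis_def)
    have "data_matrix y *v axis i 1 = y i"
      by (simp add: matrix_vector_mult_basis column_def data_matrix_def vec_eq_iff)
    then have "yN - data_matrix y *v d = r - t *\<^sub>R y i"
      by (simp add: d_def r_def matrix_vector_right_distrib matrix_vector_mult_scaleR)
    then have sq: "(norm (yN - data_matrix y *v d))\<^sup>2
        = (norm r)\<^sup>2 - 2 * t * (y i \<bullet> r) + t\<^sup>2 * (norm (y i))\<^sup>2"
      unfolding power2_norm_eq_inner
      by (simp add: inner_diff_left inner_diff_right inner_commute power2_eq_square)
    have l1: "l1norm (diag_matrix w *v v)
        = w i * \<bar>v $ i\<bar> + (\<Sum>k\<in>UNIV - {i}. w k * \<bar>v $ k\<bar>)" for v :: "real ^ 'm"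
      using w by (simp add: l1norm_def diag_matrix_mult_nth abs_mult less_imp_le
          sum.remove[of UNIV i])
    have "(\<Sum>k\<in>UNIV - {i}. w k * \<bar>d $ k\<bar>) = (\<Sum>k\<in>UNIV - {i}. w k * \<bar>c $ k\<bar>)"
      by (rule sum.cong) (auto simp: d)
    then have "l1norm (diag_matrix w *v d)
        = l1norm (diag_matrix w *v c) - w i * \<bar>c $ i\<bar> + w i * \<bar>c $ i + t\<bar>"
      using l1[of c] l1[of d] d[of i] by simp
    then have "lam * l1norm (diag_matrix w *v d)
        = lam * l1norm (diag_matrix w *v c) - lam * w i * \<bar>c $ i\<bar> + lam * w i * \<bar>c $ i + t\<bar>"
      by (simp only:) (simp add: algebra_simps)
    moreover have "lasso_objective lam w y yN c \<le> lasso_objective lam w y yN d"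
      using sol by (simp add: lasso_solution_def is_arg_min_linorder)
    ultimately show ?thesis
      unfolding lasso_objective_def sq by (simp add: algebra_simps flip: r_def)
  qed
  have "lam * w i \<ge> 0" using \<open>lam > 0\<close> w[of i] by simp
  from abs_subgradient[OF this min]
  show "\<bar>y i \<bullet> r\<bar> \<le> lam * w i" "(y i \<bullet> r) * c $ i = lam * w i * \<bar>c $ i\<bar>" .
qed

lemma dual_solution_eq_residual:
  fixes y :: "'m::finite \<Rightarrow> real ^ 'n"
  assumes lasso: "lasso_solution lam w y yN c" and dual: "dual_solution lam w y yN z"
    and lam: "lam > 0" and w: "\<And>i. w i > 0"
  shows "z = yN - data_matrix y *v c"
proof -
  define r where "r = yN - data_matrix y *v c"
  note kkt = lasso_optimality[OF lasso lam w, folded r_def]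
  have z: "\<bar>y i \<bullet> z\<bar> \<le> lam * w i" for i
    using dual by (simp add: dual_solution_def is_arg_min_linorder dual_polytope_iff w)
  have "r \<in> dual_polytope lam w y" using kkt(1) by (simp add: dual_polytope_iff w)
  with dual have min: "(norm (z - yN))\<^sup>2 \<le> (norm (r - yN))\<^sup>2"
    by (simp add: dual_solution_def is_arg_min_linorder)
  have "(z - r) \<bullet> (yN - r) = (\<Sum>i\<in>UNIV. c $ i * (y i \<bullet> z) - (y i \<bullet> r) * c $ i)"
  proof -
    have "yN - r = (\<Sum>i\<in>UNIV. c $ i *\<^sub>R y i)" by (simp add: r_def data_matrix_mult)
    then show ?thesis
      by (simp add: inner_sum_right inner_diff_left algebra_simps inner_commute)
  qed
  \<comment> \<open>Termwise: by the second optimality condition,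
    \<open>c $ i * (y i \<bullet> r)\<close> attains the upper bound
    \<open>lam * w i * \<bar>c $ i\<bar>\<close> that feasibility imposes on
    \<open>c $ i * (y i \<bullet> z)\<close>.\<close>
  also have "\<dots> \<le> 0"
  proof (rule sum_nonpos)
    fix i
    have "c $ i * (y i \<bullet> z) \<le> \<bar>c $ i\<bar> * \<bar>y i \<bullet> z\<bar>" by (metis abs_ge_self abs_mult)
    also have "\<dots> \<le> \<bar>c $ i\<bar> * (lam * w i)" using z by (intro mult_left_mono) auto
    finally show "c $ i * (y i \<bullet> z) - (y i \<bullet> r) * c $ i \<le> 0"
      using kkt(2)[of i] by (simp add: mult_ac)
  qed
  finally have vi: "(z - r) \<bullet> (yN - r) \<le> 0" .
  have "(norm (z - yN))\<^sup>2 = (norm (z - r))\<^sup>2 - 2 * ((z - r) \<bullet> (yN - r)) + (norm (r - yN))\<^sup>2"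
    by (simp add: power2_norm_eq_inner inner_diff_left inner_diff_right inner_commute)
  with min vi have "(norm (z - r))\<^sup>2 \<le> 0" by linarith
  then show ?thesis by (simp add: r_def)
qed

lemma proper_subspace_translate_hyperplane:
  fixes u :: "real ^ 'n"
  assumes "u \<noteq> 0"
  shows "proper_subspace_translate {x. u \<bullet> (x - a) = 0}"
  unfolding proper_subspace_translate_def
proof (intro exI conjI)
  show "subspace {x. u \<bullet> x = 0}" by (rule subspace_hyperplane)
  show "dim {x. u \<bullet> x = 0} < CARD('n)" using assms by (simp add: dim_hyperplane)
  show "{x. u \<bullet> (x - a) = 0} = (+) a ` {x. u \<bullet> x = 0}"
    by (auto simp: image_iff intro!: exI[of _ "_ - a"])
qed

text \<open>Here \<open>x\<close> stands for the data vector, \<open>r\<close> for its residual and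
  \<open>S\<close> for the support. Any two members of \<open>?X\<close> have the same inner product
  with \<open>u\<close>, so the offset of the hyperplane need not be computed: a member of
  \<open>?X\<close> serves as base point.\<close>

lemma prescribed_inner_subset_proper_translate:
  fixes y :: "'m \<Rightarrow> real ^ 'n"
  assumes j: "y j \<notin> span (y ` S)"
  shows "\<exists>H. proper_subspace_translate H \<and>
    {x. \<exists>r. x - r \<in> span (y ` S) \<and> (\<forall>i\<in>insert j S. y i \<bullet> r = b i)} \<subseteq> H"
    (is "\<exists>H. _ \<and> ?X \<subseteq> H")
proof -
  obtain v u where v: "v \<in> span (y ` S)" and u: "\<And>x. x \<in> span (y ` S) \<Longrightarrow> u \<bullet> x = 0"
    and yj: "y j = v + u"
    by (metis orthogonal_subspace_decomp_exists orthogonal_def)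
  from j v yj have "u \<noteq> 0" by auto
  have "v \<in> span (y ` insert j S)" using v by (metis image_mono span_mono subset_iff subset_insertI)
  moreover have "y j \<in> span (y ` insert j S)" by (simp add: span_base)
  ultimately have u_span: "u \<in> span (y ` insert j S)"
    using yj by (metis add_diff_cancel_left' span_diff)
  have "u \<bullet> (x - a) = 0" if "x \<in> ?X" "a \<in> ?X" for x a
  proof -
    from that obtain r s where r: "x - r \<in> span (y ` S)" "\<forall>i\<in>insert j S. y i \<bullet> r = b i"
      and s: "a - s \<in> span (y ` S)" "\<forall>i\<in>insert j S. y i \<bullet> s = b i" by blast
    \<comment> \<open>\<open>r\<close> and \<open>s\<close> have equal inner products with all
      generators of a span containing \<open>u\<close>.\<close>
    have "orthogonal (r - s) u"
      using u_span r(2) s(2)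
      by (intro orthogonal_to_span[of u])
        (auto simp: orthogonal_def inner_diff_right inner_commute[of "r - s"])
    with u[OF r(1)] u[OF s(1)] show ?thesis
      by (simp add: orthogonal_def inner_diff_right inner_diff_left inner_commute)
  qed
  then have "\<exists>a. ?X \<subseteq> {x. u \<bullet> (x - a) = 0}"
    by (cases "?X = {}") (blast, blast)
  with proper_subspace_translate_hyperplane[OF \<open>u \<noteq> 0\<close>] show ?thesis by blast
qed

theorem lemma2p1:
  fixes y :: "'m::finite \<Rightarrow> real ^ 'n"
    and w :: "'m \<Rightarrow> real"
    and lam :: real
    and j :: 'm
  assumes dims: "CARD('n) > CARD('m) + 1"
    and indep: "inj y" "independent (range y)"
    and lam: "lam > 0"
    and w: "\<And>i. w i > 0"
  shows
    "(\<forall>yN c z.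
        lasso_solution lam w y yN c \<longrightarrow> dual_solution lam w y yN z \<longrightarrow>
        c $ j \<noteq> 0 \<longrightarrow> (1 / w j) * \<bar>y j \<bullet> z\<bar> = lam)
   \<and> (\<exists>\<H>. finite \<H> \<and> (\<forall>H\<in>\<H>. proper_subspace_translate H) \<and>
        (\<forall>yN c z.
          lasso_solution lam w y yN c \<longrightarrow> dual_solution lam w y yN z \<longrightarrow>
          (1 / w j) * \<bar>y j \<bullet> z\<bar> = lam \<longrightarrow> c $ j = 0 \<longrightarrow> (\<exists>H\<in>\<H>. yN \<in> H)))"
proof (rule conjI)
  show "\<forall>yN c z. lasso_solution lam w y yN c \<longrightarrow> dual_solution lam w y yN z \<longrightarrow>
      c $ j \<noteq> 0 \<longrightarrow> (1 / w j) * \<bar>y j \<bullet> z\<bar> = lam"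
  proof (intro allI impI)
    fix yN c z
    assume sol: "lasso_solution lam w y yN c" "dual_solution lam w y yN z" and cj: "c $ j \<noteq> 0"
    have "\<bar>(y j \<bullet> z) * c $ j\<bar> = lam * w j * \<bar>c $ j\<bar>"
      using lasso_optimality(2)[OF sol(1) lam w, of j] dual_solution_eq_residual[OF sol lam w]
        lam w[of j] by (simp add: abs_mult)
    with cj w[of j] show "(1 / w j) * \<bar>y j \<bullet> z\<bar> = lam"
      by (simp add: abs_mult field_simps)
  qed
next
  \<comment> \<open>Since \<open>c $ j = 0\<close>, the slot \<open>s j\<close> is free to record
    the sign of \<open>y j \<bullet> z\<close>; the other slots hold the signs of \<open>c\<close>.
    Hence \<open>supp\<close> leaves out \<open>j\<close>.\<close>
  define supp :: "('m \<Rightarrow> real) \<Rightarrow> 'm set" where "supp s = {i. i \<noteq> j \<and> s i \<noteq> 0}" for s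
  define X where "X s = {x. \<exists>r. x - r \<in> span (y ` supp s) \<and>
      (\<forall>i\<in>insert j (supp s). y i \<bullet> r = lam * w i * s i)}" for s
  define F :: "('m \<Rightarrow> real) set" where "F = UNIV \<rightarrow>\<^sub>E {-1, 0, 1}"
  have "y j \<notin> span (y ` supp s)" for s
  proof
    assume "y j \<in> span (y ` supp s)"
    \<comment> \<open>Independence of the set \<open>range y\<close> does not exclude repeated
      columns; injectivity does.\<close>
    moreover have "y ` supp s \<subseteq> range y - {y j}"
      using indep(1) by (auto simp: supp_def dest: injD)
    ultimately have "y j \<in> span (range y - {y j})" using span_mono by blast
    with indep(2) show False by (auto simp: dependent_def)
  qed
  then have "\<exists>H. proper_subspace_translate H \<and> X s \<subseteq> H" for s
    unfolding X_def by (rule prescribed_inner_subset_proper_translate)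
  then obtain H where H: "\<And>s. proper_subspace_translate (H s)" "\<And>s. X s \<subseteq> H s" by metis
  show "\<exists>\<H>. finite \<H> \<and> (\<forall>H\<in>\<H>. proper_subspace_translate H) \<and>
        (\<forall>yN c z.
          lasso_solution lam w y yN c \<longrightarrow> dual_solution lam w y yN z \<longrightarrow>
          (1 / w j) * \<bar>y j \<bullet> z\<bar> = lam \<longrightarrow> c $ j = 0 \<longrightarrow> (\<exists>H\<in>\<H>. yN \<in> H))"
  proof (intro exI[of _ "H ` F"] conjI allI impI)
    show "finite (H ` F)" unfolding F_def by (intro finite_imageI finite_PiE) auto
    show "\<forall>H\<in>H ` F. proper_subspace_translate H" using H(1) by auto
  next
    fix yN c z
    assume sol: "lasso_solution lam w y yN c" "dual_solution lam w y yN z"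
      and act: "(1 / w j) * \<bar>y j \<bullet> z\<bar> = lam" and cj: "c $ j = 0"
    have z: "z = yN - data_matrix y *v c" by (rule dual_solution_eq_residual[OF sol lam w])
    define s where "s i = (if i = j then sgn (y j \<bullet> z) else sgn (c $ i))" for i
    have "s \<in> F" by (auto simp: F_def PiE_UNIV_domain s_def sgn_real_def)
    have "yN - z \<in> span (y ` supp s)"
    proof -
      have "c $ i *\<^sub>R y i \<in> span (y ` supp s)" for i
      proof (cases "i \<in> supp s")
        case True
        then show ?thesis by (blast intro: span_scale span_base)
      next
        case False
        then have "c $ i = 0" using cj by (auto simp: supp_def s_def sgn_zero_iff split: if_splits)
        then show ?thesis by (simp add: span_zero)
      qed
      then show ?thesis by (simp add: z data_matrix_mult span_sum)
    qed
    moreover have "y i \<bullet> z = lam * w i * s i" if "i \<in> insert j (supp s)" for i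
    proof (cases "i = j")
      case True
      have "\<bar>y j \<bullet> z\<bar> = lam * w j" using act w[of j] by (simp add: field_simps)
      then show ?thesis using True by (metis abs_mult_sgn s_def)
    next
      case False
      then have ci: "c $ i \<noteq> 0" using that by (auto simp: supp_def s_def)
      \<comment> \<open>Writing \<open>\<bar>c $ i\<bar>\<close> as
        \<open>c $ i * sgn (c $ i)\<close> allows the nonzero factor \<open>c $ i\<close> to be
        cancelled.\<close>
      have "(y i \<bullet> z) * c $ i = (lam * w i * sgn (c $ i)) * c $ i"
        using lasso_optimality(2)[OF sol(1) lam w, of i] by (simp add: z abs_sgn mult_ac)
      then show ?thesis using ci False by (simp add: s_def)
    qed
    ultimately have "yN \<in> X s" unfolding X_def by blast
    with H(2) \<open>s \<in> F\<close> show "\<exists>H\<in>H ` F. yN \<in> H" by blast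
  qed
qed

end
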